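(* Let $\mathcal{C}_0$ be a quasi self-dual code of length $n$ over $I_5$ with generator matrix $G_0=(\mathbf{r}_i)$, where $\mathbf{r}_i$ is the $i$th row of $G_0$ for $i=1,2,\dots,m$. If $\mathbf{x}\in\mathbb{F}_5^n$ and $\iota,\kappa,\lambda,\mu,\nu\in J=\{0,\mathtt{b},2\mathtt{b},3\mathtt{b},4\mathtt{b}\}$ are nonzero elements, then the code $\mathcal{C}$ over $I_5$ with generator matrix $$G=\left(\begin{array}{ccccc|c} \iota&0&0&0&0&\iota\mathbf{x}\\ 0&\kappa&0&0&0&\kappa\mathbf{x}\\ 0&0&\lambda&0&0&\lambda\mathbf{x}\\ 0&0&0&\mu&0&\mu\mathbf{x}\\ 0&0&0&0&\nu&\nu\mathbf{x}\\ \hline 4(\mathbf{x},\mathbf{r}_1)&4(\mathbf{x},\mathbf{r}_1)&4(\mathbf{x},\mathbf{r}_1)&4(\mathbf{x},\mathbf{r}_1)&4(\mathbf{x},\mathbf{r}_1)&\mathbf{r}_1\\ \vdots&\vdots&\vdots&\vdots&\vdots&\vdots\\ 4(\mathbf{x},\mathbf{r}_m)&4(\mathbf{x},\mathbf{r}_m)&4(\mathbf{x},\mathbf{r}_m)&4(\mathbf{x},\mathbf{r}_m)&4(\mathbf{x},\mathbf{r}_m)&\mathbf{r}_m\end{array}\right)$$ is a quasi self-dual code of length $n+5$.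
   Context: $I_5$ is the commutative ring without unity of order 25 and characteristic 5 generated by $\mathtt{a},\mathtt{b}$ with relations $5\mathtt{a}=5\mathtt{b}=0$, $\mathtt{a}^2=\mathtt{b}$, $\mathtt{a}\mathtt{b}=0$ (hence $\mathtt{b}^2=0$); every element is uniquely $\mathtt{a}x+\mathtt{b}y$ with $x,y\in\mathbb{F}_5$. $J=\{j\mathtt{b}:0\le j<5\}$ is its maximal ideal. $\mathbb{F}_5$ acts naturally on $I_5$ by repeated addition. A linear code of length $n$ over $I_5$ is an $I_5$-submodule of $I_5^n$; the code with generator matrix $G$ is the smallest $I_5$-submodule (additive subgroup closed under multiplication by $I_5$) containing the rows of $G$. For $\mathbf{x}\in\mathbb{F}_5^n$, $\mathbf{r}\in I_5^n$, $(\mathbf{x},\mathbf{r})=\sum_i x_ir_i\in I_5$; for $\mathbf{y},\mathbf{z}\in I_5^n$, $(\mathbf{y},\mathbf{z})=\sum_i y_iz_i$. For $\nu\in I_5$ and $\mathbf{x}\in\mathbb{F}_5^n$, $\nu\mathbf{x}=(\nu x_1,\dots,\nu x_n)$. A code $\mathcal{C}$ is self-orthogonal if $(\mathbf{y},\mathbf{z})=0$ for all $\mathbf{y},\mathbf{z}\in\mathcal{C}$. A quasi self-dual code of length $n$ is a self-orthogonal code of length $n$ of size $5^n$. *)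

theory Defs
  imports "Jordan_Normal_Form.Matrix" "HOL-Library.Numeral_Type"
begin

text \<open>The field with five elements is the numeral type \<open>5\<close>, the integers modulo 5.
  \<open>Coords x y\<close> is the element \<open>a x + b y\<close> of \<open>I\<^sub>5\<close>. Since \<open>a\<^sup>2 = b\<close>, \<open>a b = 0\<close> and
  \<open>b\<^sup>2 = 0\<close>, the product of \<open>a x + b y\<close> and \<open>a x' + b y'\<close> is \<open>b x x'\<close>.\<close>

datatype I5 = Coords (a_coeff: 5) (b_coeff: 5)

instantiation I5 :: comm_ring
begin

definition zero_I5 :: I5 where
  "0 = Coords 0 0"

definition plus_I5 :: "I5 \<Rightarrow> I5 \<Rightarrow> I5" where
  "r + s = Coords (a_coeff r + a_coeff s) (b_coeff r + b_coeff s)"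

definition uminus_I5 :: "I5 \<Rightarrow> I5" where
  "- r = Coords (- a_coeff r) (- b_coeff r)"

definition minus_I5 :: "I5 \<Rightarrow> I5 \<Rightarrow> I5" where
  "r - s = Coords (a_coeff r - a_coeff s) (b_coeff r - b_coeff s)"

definition times_I5 :: "I5 \<Rightarrow> I5 \<Rightarrow> I5" where
  "r * s = Coords 0 (a_coeff r * a_coeff s)"

instance
  by standard
    (simp_all add: zero_I5_def plus_I5_def uminus_I5_def minus_I5_def times_I5_def
      algebra_simps)

end

definition I5_a :: I5 where "I5_a = Coords 1 0"
definition I5_b :: I5 where "I5_b = Coords 0 1"

definition scal :: "5 \<Rightarrow> I5 \<Rightarrow> I5" where
  "scal x r = (\<Sum>_<(LEAST k. of_nat k = x). r)"

lemma sum_I5: "(\<Sum>_<(k::nat). r) = Coords (of_nat k * a_coeff r) (of_nat k * b_coeff r)"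
  by (induction k) (simp_all add: zero_I5_def plus_I5_def algebra_simps)

lemma ex_of_nat_5: "\<exists>k. of_nat k = (x::5)"
proof (cases x rule: bit1_cases)
  case (of_int z)
  then have "of_nat (nat z) = x" by simp
  then show ?thesis ..
qed

lemma scal_Coords: "scal x r = Coords (x * a_coeff r) (x * b_coeff r)"
  unfolding scal_def sum_I5 using LeastI_ex[OF ex_of_nat_5[of x]] by simp

lemma scal_of_nat: "scal (of_nat k) r = (\<Sum>_<k. r)"
  by (simp add: scal_Coords sum_I5)

lemma F5_inverse: "x \<noteq> 0 \<Longrightarrow> \<exists>y. x * y = (1::5)"
proof (cases x rule: bit1_cases)
  case (of_int z)
  assume "x \<noteq> 0"
  then have "z \<noteq> 0" using of_int by auto
  then have "z = 1 \<or> z = 2 \<or> z = 3 \<or> z = 4" using of_int by auto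
  moreover have "(1::5) * 1 = 1" "(2::5) * 3 = 1" "(3::5) * 2 = 1" "(4::5) * 4 = 1"
    by simp_all
  ultimately show ?thesis using of_int by (metis of_int_1 of_int_numeral)
qed

lemma I5_relations:
  "I5_a * I5_a = I5_b" "I5_a * I5_b = 0" "(\<Sum>_<5::nat. I5_a) = 0" "(\<Sum>_<5::nat. I5_b) = 0"
  by (simp_all add: I5_a_def I5_b_def times_I5_def zero_I5_def sum_I5)

lemma I5_unique_representation: "\<exists>!(x, y). r = scal x I5_a + scal y I5_b"
  by (cases r) (auto simp: scal_Coords I5_a_def I5_b_def plus_I5_def)

lemma card_I5: "card (UNIV :: I5 set) = 25"
proof -
  have "bij_betw (\<lambda>(x, y). Coords x y) (UNIV :: (5 \<times> 5) set) UNIV"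
    by (rule bij_betwI[of _ _ _ "\<lambda>r. (a_coeff r, b_coeff r)"]) auto
  then have "card (UNIV :: (5 \<times> 5) set) = card (UNIV :: I5 set)"
    by (rule bij_betw_same_card)
  then show ?thesis by simp
qed

lemma I5_no_unity: "\<not> (\<exists>e::I5. \<forall>r. e * r = r)"
proof
  assume "\<exists>e::I5. \<forall>r. e * r = r"
  then obtain e :: I5 where "e * I5_a = I5_a" by blast
  then show False by (simp add: I5_a_def times_I5_def)
qed

definition J :: "I5 set" where
  "J = {scal j I5_b | j. True}"

definition linear_code :: "nat \<Rightarrow> I5 vec set \<Rightarrow> bool" where
  "linear_code n C \<longleftrightarrow>
     C \<subseteq> carrier_vec n \<and> 0\<^sub>v n \<in> C \<and>
     (\<forall>y\<in>C. \<forall>z\<in>C. y + z \<in> C) \<and> (\<forall>y\<in>C. - y \<in> C) \<and>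
     (\<forall>r. \<forall>y\<in>C. r \<cdot>\<^sub>v y \<in> C)"

text \<open>As \<open>I\<^sub>5\<close> has no unity, the \<open>I\<^sub>5\<close>-linear combinations of the rows need not
  contain the rows, so the generated code is the least code containing the rows.\<close>

definition generated_code :: "I5 mat \<Rightarrow> I5 vec set" where
  "generated_code G = \<Inter> {C. linear_code (dim_col G) C \<and> set (rows G) \<subseteq> C}"

definition self_orthogonal :: "I5 vec set \<Rightarrow> bool" where
  "self_orthogonal C \<longleftrightarrow> (\<forall>y\<in>C. \<forall>z\<in>C. y \<bullet> z = 0)"

definition quasi_self_dual :: "nat \<Rightarrow> I5 vec set \<Rightarrow> bool" where
  "quasi_self_dual n C \<longleftrightarrow> linear_code n C \<and> self_orthogonal C \<and> card C = 5 ^ n"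

definition mixed_prod :: "5 vec \<Rightarrow> I5 vec \<Rightarrow> I5" where
  "mixed_prod x r = (\<Sum>i<dim_vec r. scal (x $ i) (r $ i))"

definition ring_times_vec :: "I5 \<Rightarrow> 5 vec \<Rightarrow> I5 vec" where
  "ring_times_vec \<nu> x = vec (dim_vec x) (\<lambda>i. scal (x $ i) \<nu>)"

lemma generated_code_least:
  assumes "G \<in> carrier_mat m n"
  shows "linear_code n (generated_code G)" "set (rows G) \<subseteq> generated_code G"
    "linear_code n C \<Longrightarrow> set (rows G) \<subseteq> C \<Longrightarrow> generated_code G \<subseteq> C"
proof -
  have n: "dim_col G = n" using assms by auto
  have "linear_code n (carrier_vec n)" by (auto simp: linear_code_def)
  moreover have "set (rows G) \<subseteq> carrier_vec n" using n rows_carrier[of G] by simp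
  ultimately have "generated_code G \<subseteq> carrier_vec n"
    unfolding generated_code_def n by blast
  then show "linear_code n (generated_code G)"
    unfolding linear_code_def generated_code_def n by auto
  show "set (rows G) \<subseteq> generated_code G"
    unfolding generated_code_def by blast
  show "linear_code n C \<Longrightarrow> set (rows G) \<subseteq> C \<Longrightarrow> generated_code G \<subseteq> C"
    unfolding generated_code_def n by blast
qed

end

theory Submission
  imports Defs
begin

text \<open>Write \<open>J\<^sup>5\<close> for the vectors of length 5 with entries in \<open>J\<close>. The map sending
  \<open>(v, c)\<close> in \<open>J\<^sup>5 \<times> C\<^sub>0\<close> to \<open>(v + 4(x,c)(1,1,1,1,1) | c + (v\<^sub>1 + \<dots> + v\<^sub>5) x)\<close> is additive, and
  its range is the code generated by \<open>G\<close>. It is injective: if \<open>(v, c)\<close> is in the kernel, all \<open>v\<^sub>i\<close>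
  equal \<open>(x,c)\<close>, so their sum vanishes in characteristic 5 and hence \<open>c = 0\<close> and \<open>v = 0\<close>. The
  range therefore has \<open>5\<^sup>5 \<cdot> 5\<^sup>n\<close> elements. It is self-orthogonal because \<open>J\<close> annihilates \<open>I\<^sub>5\<close> and
  the first five coordinates contribute \<open>5 \<cdot> 16 (x,c)(x,c') = 0\<close>.\<close>

section \<open>Coordinate arithmetic in \<open>I5\<close> and the ideal \<open>J\<close>\<close>

lemma a_coeff_zero [simp]: "a_coeff 0 = 0"
  and b_coeff_zero [simp]: "b_coeff 0 = 0"
  and a_coeff_add [simp]: "a_coeff (r + s) = a_coeff r + a_coeff s"
  and b_coeff_add [simp]: "b_coeff (r + s) = b_coeff r + b_coeff s"
  and a_coeff_uminus [simp]: "a_coeff (- r) = - a_coeff r"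
  and b_coeff_uminus [simp]: "b_coeff (- r) = - b_coeff r"
  and a_coeff_diff [simp]: "a_coeff (r - s) = a_coeff r - a_coeff s"
  and b_coeff_diff [simp]: "b_coeff (r - s) = b_coeff r - b_coeff s"
  and a_coeff_mult [simp]: "a_coeff (r * s) = 0"
  and b_coeff_mult [simp]: "b_coeff (r * s) = a_coeff r * a_coeff s"
  by (simp_all add: zero_I5_def plus_I5_def uminus_I5_def minus_I5_def times_I5_def)

lemma a_coeff_scal [simp]: "a_coeff (scal y r) = y * a_coeff r"
  and b_coeff_scal [simp]: "b_coeff (scal y r) = y * b_coeff r"
  by (simp_all add: scal_Coords)

lemma a_coeff_sum [simp]: "a_coeff (sum f A) = (\<Sum>i\<in>A. a_coeff (f i))"
  and b_coeff_sum [simp]: "b_coeff (sum f A) = (\<Sum>i\<in>A. b_coeff (f i))"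
  by (induction A rule: infinite_finite_induct) simp_all

text \<open>This reduces identities in the ring to pairs of identities over the field with five
  elements, which is how most computations below are settled.\<close>

lemma I5_eq_iff: "r = s \<longleftrightarrow> a_coeff r = a_coeff s \<and> b_coeff r = b_coeff s"
  by (cases r; cases s) simp

text \<open>In this form \<open>a_coeff_mult\<close> and \<open>b_coeff_mult\<close> show at once
  that \<open>J\<close> annihilates the whole ring.\<close>

lemma J_iff: "r \<in> J \<longleftrightarrow> a_coeff r = 0"
  by (auto simp: J_def I5_b_def I5_eq_iff)

lemma card_J: "card J = 5"
proof -
  have "J = range (Coords 0)"
    by (auto simp: J_iff image_iff I5_eq_iff)
  also have "card \<dots> = CARD(5)"
    by (rule card_image) (simp add: inj_on_def)
  finally show ?thesis
    by simp
qed

lemma finite_J: "finite J"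
  using card_J card.infinite by fastforce

lemma I5_five_times: "(\<Sum>_<5::nat. r) = (0 :: I5)"
proof -
  have "(5 :: 5) = 0"
    by simp
  then show ?thesis
    by (simp only: sum_I5 zero_I5_def of_nat_numeral mult_zero_left)
qed

text \<open>\<open>J\<close> is one-dimensional over the prime field, so any nonzero element
  generates it additively. Ring multiplication cannot serve here, because it kills
  \<open>d\<close>.\<close>

lemma J_multiple:
  assumes "d \<in> J" "d \<noteq> 0" "s \<in> J"
  shows "\<exists>k. s = (\<Sum>_<(k::nat). d)"
proof -
  \<comment> \<open>Since \<open>d\<close> lies in \<open>J\<close> and is nonzero, its
    \<open>b\<close> coordinate is invertible; the multiplier \<open>k\<close> below represents
    \<open>b_coeff s / b_coeff d\<close>.\<close>
  from assms obtain y where y: "b_coeff d * y = 1"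
    using F5_inverse[of "b_coeff d"] by (auto simp: J_iff I5_eq_iff)
  obtain k where "of_nat k = b_coeff s * y"
    using ex_of_nat_5 by blast
  then have "s = (\<Sum>_<k. d)"
    using assms y by (simp add: J_iff I5_eq_iff mult.assoc mult.commute[of y])
  then show ?thesis ..
qed

lemma dim_ring_times_vec [simp]: "dim_vec (ring_times_vec s x) = dim_vec x"
  and index_ring_times_vec [simp]: "i < dim_vec x \<Longrightarrow> ring_times_vec s x $ i = scal (x $ i) s"
  by (simp_all add: ring_times_vec_def)

lemma a_coeff_mixed_prod [simp]: "a_coeff (mixed_prod x c) = (\<Sum>i<dim_vec c. x $ i * a_coeff (c $ i))"
  and b_coeff_mixed_prod [simp]: "b_coeff (mixed_prod x c) = (\<Sum>i<dim_vec c. x $ i * b_coeff (c $ i))"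
  by (simp_all add: mixed_prod_def)

section \<open>Vectors with entries in \<open>J\<close>\<close>

definition J_vecs :: "nat \<Rightarrow> I5 vec set" where
  "J_vecs k = {v \<in> carrier_vec k. \<forall>i<k. v $ i \<in> J}"

lemma J_vecs_carrier: "v \<in> J_vecs k \<Longrightarrow> v \<in> carrier_vec k"
  by (simp add: J_vecs_def)

lemma J_vecs_zero: "0\<^sub>v k \<in> J_vecs k"
  and J_vecs_add: "v \<in> J_vecs k \<Longrightarrow> w \<in> J_vecs k \<Longrightarrow> v + w \<in> J_vecs k"
  and J_vecs_uminus: "v \<in> J_vecs k \<Longrightarrow> - v \<in> J_vecs k"
  by (auto simp: J_vecs_def J_iff)

lemma card_J_vecs: "card (J_vecs k) = 5 ^ k"
proof -
  have "J_vecs k = vec_of_list ` {xs. set xs \<subseteq> J \<and> length xs = k}"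
  proof (intro equalityI subsetI)
    fix v assume v: "v \<in> J_vecs k"
    have "set (list_of_vec v) \<subseteq> J" "length (list_of_vec v) = k"
      using v by (auto simp: J_vecs_def set_conv_nth list_of_vec_index)
    then show "v \<in> vec_of_list ` {xs. set xs \<subseteq> J \<and> length xs = k}"
      by (intro image_eqI[where x = "list_of_vec v"]) (simp_all add: vec_list)
  next
    fix v assume "v \<in> vec_of_list ` {xs. set xs \<subseteq> J \<and> length xs = k}"
    then obtain xs where xs: "v = vec_of_list xs" "set xs \<subseteq> J" "length xs = k"
      by blast
    have "xs ! i \<in> J" if "i < k" for i
      using xs that nth_mem by blast
    then show "v \<in> J_vecs k"
      using xs(3) unfolding xs(1)
      by (auto simp: J_vecs_def vec_of_list_index intro!: carrier_vecI)
  qed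
  also have "card \<dots> = card {xs. set xs \<subseteq> J \<and> length xs = k}"
    by (rule card_image, rule inj_on_inverseI[where g = list_of_vec], rule list_vec)
  also have "\<dots> = 5 ^ k"
    by (simp only: card_lists_length_eq[OF finite_J] card_J)
  finally show ?thesis .
qed

section \<open>The building-up map: additivity, injectivity, inner products\<close>

text \<open>If the left-hand entries contributed by the top rows add up to \<open>v\<close>, their
  right-hand parts add up to \<open>(\<Sum>i<5. v $ i)\<close> times \<open>x\<close>; the lower
  rows put \<open>4(x,c)\<close> into each of the five left positions. The factor \<open>4\<close>
  is -1 modulo 5.\<close>

definition building_up :: "5 vec \<Rightarrow> I5 vec \<Rightarrow> I5 vec \<Rightarrow> I5 vec" where
  "building_up x v c =
     (v + vec 5 (\<lambda>_. scal 4 (mixed_prod x c))) @\<^sub>v (c + ring_times_vec (\<Sum>i<5. v $ i) x)"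

lemma dim_building_up [simp]: "dim_vec (building_up x v c) = dim_vec x + 5"
  by (simp add: building_up_def)

lemma building_up_carrier:
  "x \<in> carrier_vec n \<Longrightarrow> building_up x v c \<in> carrier_vec (n + 5)"
  by (intro carrier_vecI) simp

lemma index_building_up:
  assumes "i < dim_vec x + 5"
  shows "building_up x v c $ i =
    (if i < 5 then v $ i + scal 4 (mixed_prod x c)
     else c $ (i - 5) + scal (x $ (i - 5)) (\<Sum>i<5. v $ i))"
  using assms by (auto simp: building_up_def)

lemma building_up_add:
  assumes "x \<in> carrier_vec n" "v \<in> carrier_vec 5" "w \<in> carrier_vec 5"
    "c \<in> carrier_vec n" "d \<in> carrier_vec n"
  shows "building_up x (v + w) (c + d) = building_up x v c + building_up x w d"
  using assms
  by (intro eq_vecI) (auto simp: index_building_up I5_eq_iff algebra_simps sum.distrib)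

lemma building_up_zero:
  "x \<in> carrier_vec n \<Longrightarrow> building_up x (0\<^sub>v 5) (0\<^sub>v n) = 0\<^sub>v (n + 5)"
  by (intro eq_vecI) (auto simp: index_building_up I5_eq_iff)

lemma building_up_uminus:
  assumes "x \<in> carrier_vec n" "v \<in> carrier_vec 5" "c \<in> carrier_vec n"
  shows "building_up x (- v) (- c) = - building_up x v c"
  using assms
  by (intro eq_vecI) (auto simp: index_building_up I5_eq_iff sum_negf)

text \<open>\<open>J\<close> annihilates the ring, so both contributions of \<open>v\<close>
  disappear, while the mixed product commutes with multiplication by \<open>r\<close>.\<close>

lemma building_up_smult:
  assumes "x \<in> carrier_vec n" "v \<in> J_vecs 5" "c \<in> carrier_vec n"
  shows "r \<cdot>\<^sub>v building_up x v c = building_up x (0\<^sub>v 5) (r \<cdot>\<^sub>v c)"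
  using assms
  by (intro eq_vecI)
    (auto simp: index_building_up I5_eq_iff J_vecs_def J_iff algebra_simps sum_distrib_left)

lemma building_up_eq_zero:
  assumes x: "x \<in> carrier_vec n" and v: "v \<in> carrier_vec 5" and c: "c \<in> carrier_vec n"
    and eq: "building_up x v c = 0\<^sub>v (n + 5)"
  shows "v = 0\<^sub>v 5 \<and> c = 0\<^sub>v n"
proof -
  have "v $ i + scal 4 (mixed_prod x c) = 0" if "i < 5" for i
    using arg_cong[OF eq, of "\<lambda>u. u $ i"] x that by (simp add: index_building_up)
  then have vi: "v $ i = - scal 4 (mixed_prod x c)" if "i < 5" for i
    using that by (simp add: eq_neg_iff_add_eq_0)
  then have sum0: "(\<Sum>i<5. v $ i) = 0"
    by (simp add: I5_five_times)
  have c0: "c = 0\<^sub>v n"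
  proof (rule eq_vecI)
    fix i assume "i < dim_vec (0\<^sub>v n)"
    then have "i < n" by simp
    moreover from this have "building_up x v c $ (i + 5) = 0"
      by (simp add: eq)
    ultimately show "c $ i = 0\<^sub>v n $ i"
      using x sum0 by (simp add: index_building_up I5_eq_iff)
  qed (use c in simp)
  \<comment> \<open>Once \<open>c\<close> is zero, so is its mixed product with \<open>x\<close>,
    and \<open>vi\<close> makes every entry of \<open>v\<close> vanish.\<close>
  have "v = 0\<^sub>v 5"
    using v vi c0 by (intro eq_vecI) (auto simp: I5_eq_iff)
  with c0 show ?thesis by simp
qed

text \<open>Additivity reduces injectivity to the trivial kernel. Differences are written
  \<open>v + - w\<close> so that \<open>building_up_add\<close> and
  \<open>building_up_uminus\<close> apply.\<close>

lemma building_up_inj: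
  assumes x: "x \<in> carrier_vec n"
    and v: "v \<in> carrier_vec 5" "w \<in> carrier_vec 5"
    and c: "c \<in> carrier_vec n" "d \<in> carrier_vec n"
    and eq: "building_up x v c = building_up x w d"
  shows "v = w \<and> c = d"
proof -
  have "building_up x (v + - w) (c + - d) = building_up x v c + building_up x (- w) (- d)"
    using x v c by (intro building_up_add) auto
  also have "\<dots> = 0\<^sub>v (n + 5)"
    using x v c by (simp add: building_up_uminus eq building_up_carrier)
  finally have diff: "v + - w = 0\<^sub>v 5 \<and> c + - d = 0\<^sub>v n"
    using x v c by (intro building_up_eq_zero) auto
  have "v $ i = w $ i" if "i < 5" for i
  proof -
    have "(v + - w) $ i = 0"
      using diff that by simp
    then show ?thesis
      using v that by simp
  qed
  moreover have "c $ i = d $ i" if "i < n" for i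
  proof -
    have "(c + - d) $ i = 0"
      using diff that by simp
    then show ?thesis
      using c that by simp
  qed
  ultimately show ?thesis
    using v c by (auto intro!: eq_vecI)
qed

text \<open>The map preserves inner products whether or not they vanish, so self-orthogonality
  passes directly from a code to its image.\<close>

lemma building_up_scalar_prod:
  assumes x: "x \<in> carrier_vec n"
    and v: "v \<in> J_vecs 5" "w \<in> J_vecs 5"
    and c: "c \<in> carrier_vec n" "d \<in> carrier_vec n"
  shows "building_up x v c \<bullet> building_up x w d = c \<bullet> d"
proof -
  have car: "u + vec 5 f \<in> carrier_vec 5" for u :: "I5 vec" and f
    by (intro carrier_vecI) simp
  have car': "u + ring_times_vec s x \<in> carrier_vec n" for u s
    using x by (intro carrier_vecI) simp
  have "building_up x v c \<bullet> building_up x w d =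
      (v + vec 5 (\<lambda>_. scal 4 (mixed_prod x c))) \<bullet> (w + vec 5 (\<lambda>_. scal 4 (mixed_prod x d))) +
      (c + ring_times_vec (\<Sum>i<5. v $ i) x) \<bullet> (d + ring_times_vec (\<Sum>i<5. w $ i) x)"
    unfolding building_up_def by (rule scalar_prod_append[OF car car' car car'])
  also have "(v + vec 5 (\<lambda>_. scal 4 (mixed_prod x c))) \<bullet> (w + vec 5 (\<lambda>_. scal 4 (mixed_prod x d))) = 0"
  proof -
    \<comment> \<open>The entries of \<open>v\<close> and \<open>w\<close> have \<open>a\<close>
      coordinate zero and drop out of every product, leaving five equal terms.\<close>
    have "(v + vec 5 (\<lambda>_. scal 4 (mixed_prod x c))) \<bullet> (w + vec 5 (\<lambda>_. scal 4 (mixed_prod x d))) =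
        (\<Sum>i<5::nat. scal 4 (mixed_prod x c) * scal 4 (mixed_prod x d))"
      unfolding scalar_prod_def
    proof (rule sum.cong)
      fix i :: nat assume "i \<in> {..<5}"
      then have "i < 5" "a_coeff (v $ i) = 0" "a_coeff (w $ i) = 0"
        using v by (simp_all add: J_vecs_def J_iff)
      then show "(v + vec 5 (\<lambda>_. scal 4 (mixed_prod x c))) $ i * (w + vec 5 (\<lambda>_. scal 4 (mixed_prod x d))) $ i =
          scal 4 (mixed_prod x c) * scal 4 (mixed_prod x d)"
        by (simp add: I5_eq_iff)
    qed auto
    then show ?thesis
      by (simp only: I5_five_times)
  qed
  \<comment> \<open>The added multiples of \<open>x\<close> have entries in \<open>J\<close>, being
    field multiples of sums of elements of \<open>J\<close>, so they contribute nothing.\<close>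
  also have "(c + ring_times_vec (\<Sum>i<5. v $ i) x) \<bullet> (d + ring_times_vec (\<Sum>i<5. w $ i) x) = c \<bullet> d"
    using x v c by (auto simp: scalar_prod_def I5_eq_iff J_vecs_def J_iff)
  finally show ?thesis by simp
qed

section \<open>The range of the map as a quasi self-dual code\<close>

definition building_up_code :: "5 vec \<Rightarrow> I5 vec set \<Rightarrow> I5 vec set" where
  "building_up_code x C = (\<lambda>(v, c). building_up x v c) ` (J_vecs 5 \<times> C)"

lemma building_up_code_linear:
  assumes x: "x \<in> carrier_vec n" and C: "linear_code n C"
  shows "linear_code (n + 5) (building_up_code x C)"
proof -
  have Cn: "c \<in> carrier_vec n" if "c \<in> C" for c
    using C that by (auto simp: linear_code_def)
  have I: "building_up x v c \<in> building_up_code x C" if "v \<in> J_vecs 5" "c \<in> C" for v c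
    using that by (auto simp: building_up_code_def)
  have "0\<^sub>v (n + 5) \<in> building_up_code x C"
    using I[OF J_vecs_zero, of "0\<^sub>v n"] C x by (simp add: building_up_zero linear_code_def)
  moreover have "y + z \<in> building_up_code x C"
    if yz: "y \<in> building_up_code x C" "z \<in> building_up_code x C" for y z
  proof -
    from yz obtain v c w d where
      "y = building_up x v c" "z = building_up x w d" "v \<in> J_vecs 5" "w \<in> J_vecs 5" "c \<in> C" "d \<in> C"
      by (auto simp: building_up_code_def)
    moreover from this have "building_up x (v + w) (c + d) \<in> building_up_code x C"
      using C by (intro I J_vecs_add) (auto simp: linear_code_def)
    ultimately show ?thesis
      using x by (simp add: building_up_add[OF x] Cn J_vecs_carrier)
  qed
  moreover have "- y \<in> building_up_code x C \<and> r \<cdot>\<^sub>v y \<in> building_up_code x C"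
    if y: "y \<in> building_up_code x C" for y r
  proof -
    from y obtain v c where vc: "y = building_up x v c" "v \<in> J_vecs 5" "c \<in> C"
      by (auto simp: building_up_code_def)
    \<comment> \<open>The preimage of a ring multiple is \<open>(0, r c)\<close>, not a pair with
      first component \<open>v\<close>.\<close>
    then have "building_up x (- v) (- c) \<in> building_up_code x C"
      "building_up x (0\<^sub>v 5) (r \<cdot>\<^sub>v c) \<in> building_up_code x C"
      using C by (auto intro!: I J_vecs_uminus J_vecs_zero simp: linear_code_def)
    then show ?thesis
      using x vc by (simp add: building_up_uminus[OF x] building_up_smult[OF x] Cn J_vecs_carrier)
  qed
  moreover have "building_up_code x C \<subseteq> carrier_vec (n + 5)"
    using building_up_carrier[OF x] by (auto simp: building_up_code_def)
  ultimately show ?thesis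
    unfolding linear_code_def by blast
qed

lemma building_up_code_quasi_self_dual:
  assumes x: "x \<in> carrier_vec n" and C: "quasi_self_dual n C"
  shows "quasi_self_dual (n + 5) (building_up_code x C)"
proof -
  have lin: "linear_code n C" and so: "self_orthogonal C" and card: "card C = 5 ^ n"
    using C by (auto simp: quasi_self_dual_def)
  have Cn: "c \<in> carrier_vec n" if "c \<in> C" for c
    using lin that by (auto simp: linear_code_def)
  have "inj_on (\<lambda>(v, c). building_up x v c) (J_vecs 5 \<times> C)"
    using building_up_inj[OF x J_vecs_carrier J_vecs_carrier Cn Cn] by (auto intro!: inj_onI)
  then have "card (building_up_code x C) = 5 ^ (n + 5)"
    by (simp add: building_up_code_def card_image card_cartesian_product card card_J_vecs power_add)
  moreover have "self_orthogonal (building_up_code x C)"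
    using so Cn
    by (auto simp: self_orthogonal_def building_up_code_def building_up_scalar_prod[OF x])
  ultimately show ?thesis
    using building_up_code_linear[OF x lin] by (simp add: quasi_self_dual_def)
qed

section \<open>Identifying the range with the generated code\<close>

text \<open>Repeated addition of one top row reaches every element of \<open>J\<close> in its
  position, and adding up the five positions gives every \<open>v\<close>. Only additive closure of
  \<open>D\<close> can help, since ring elements send the top rows to zero.\<close>

lemma building_up_J_vecs_mem:
  assumes x: "x \<in> carrier_vec n" and D: "linear_code (n + 5) D"
    and d: "\<And>i. i < 5 \<Longrightarrow> d i \<in> J" "\<And>i. i < 5 \<Longrightarrow> d i \<noteq> 0"
    and top: "\<And>i. i < 5 \<Longrightarrow> building_up x (vec 5 (\<lambda>j. if i = j then d i else 0)) (0\<^sub>v n) \<in> D"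
    and v: "v \<in> J_vecs 5"
  shows "building_up x v (0\<^sub>v n) \<in> D"
proof -
  \<comment> \<open>Vectors are kept in the form \<open>vec 5 f\<close>, so that sums are formed
    pointwise on the coefficient functions.\<close>
  have add: "building_up x (vec 5 (\<lambda>j. f j + g j)) (0\<^sub>v n) \<in> D"
    if fg: "building_up x (vec 5 f) (0\<^sub>v n) \<in> D" "building_up x (vec 5 g) (0\<^sub>v n) \<in> D" for f g
  proof -
    have "vec 5 (\<lambda>j. f j + g j) = vec 5 f + vec 5 g"
      by auto
    then have "building_up x (vec 5 (\<lambda>j. f j + g j)) (0\<^sub>v n) =
        building_up x (vec 5 f) (0\<^sub>v n) + building_up x (vec 5 g) (0\<^sub>v n)"
      using building_up_add[OF x, of "vec 5 f" "vec 5 g" "0\<^sub>v n" "0\<^sub>v n"] by simp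
    then show ?thesis
      using fg D by (simp add: linear_code_def)
  qed
  have zero: "building_up x (vec 5 (\<lambda>_. 0)) (0\<^sub>v n) \<in> D"
    using building_up_zero[OF x] D by (simp add: linear_code_def zero_vec_def)
  have sum: "building_up x (vec 5 (\<lambda>j. \<Sum>k<l. f k j)) (0\<^sub>v n) \<in> D"
    if "\<And>k. k < l \<Longrightarrow> building_up x (vec 5 (f k)) (0\<^sub>v n) \<in> D" for l :: nat and f
    using that
  proof (induction l)
    case (Suc l)
    then show ?case
      using add[of "\<lambda>j. \<Sum>k<l. f k j" "f l"] by simp
  qed (simp add: zero)
  have "building_up x (vec 5 (\<lambda>j. if i = j then v $ i else 0)) (0\<^sub>v n) \<in> D" if i: "i < 5" for i
  proof -
    obtain k where "v $ i = (\<Sum>_<(k::nat). d i)"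
      using J_multiple[OF d[OF i], of "v $ i"] v i by (auto simp: J_vecs_def)
    then have "vec 5 (\<lambda>j. if i = j then v $ i else 0) =
        vec 5 (\<lambda>j. \<Sum>_<k. if i = j then d i else 0)"
      by auto
    then show ?thesis
      using sum[of k "\<lambda>_ j. if i = j then d i else 0"] top[OF i] by simp
  qed
  \<comment> \<open>This decomposes \<open>v\<close> into its five one-position parts, to which
    \<open>sum\<close> applies.\<close>
  then have "building_up x (vec 5 (\<lambda>j. \<Sum>i<5. if i = j then v $ i else 0)) (0\<^sub>v n) \<in> D"
    by (intro sum)
  moreover have "vec 5 (\<lambda>j. \<Sum>i<5. if i = j then v $ i else 0) = v"
    using v by (intro eq_vecI) (auto simp: J_vecs_def)
  ultimately show ?thesis by simp
qed

text \<open>Both inclusions come from minimality of a generated code: the range is a linear code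
  containing the rows of \<open>H\<close>, and, conversely, the code of \<open>H\<close> pulls back
  to a linear code containing the rows of \<open>G\<close>.\<close>

lemma generated_code_building_up:
  assumes G: "G \<in> carrier_mat m n" and x: "x \<in> carrier_vec n"
    and d: "\<And>i. i < 5 \<Longrightarrow> d i \<in> J" "\<And>i. i < 5 \<Longrightarrow> d i \<noteq> 0"
    and H: "H \<in> carrier_mat (5 + m) (n + 5)"
    and top: "\<And>i. i < 5 \<Longrightarrow> row H i = building_up x (vec 5 (\<lambda>j. if i = j then d i else 0)) (0\<^sub>v n)"
    and bottom: "\<And>i. i < m \<Longrightarrow> row H (5 + i) = building_up x (0\<^sub>v 5) (row G i)"
  shows "generated_code H = building_up_code x (generated_code G)"
proof
  note gen = generated_code_least[OF G]
  have rowG: "row G i \<in> generated_code G" if "i < m" for i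
    using gen(2) G that by (auto simp: rows_def)
  have zero: "0\<^sub>v n \<in> generated_code G"
    using gen(1) by (simp add: linear_code_def)
  \<comment> \<open>A top row is the image of a one-position vector over \<open>J\<close> paired
    with zero; a lower row is the image of zero paired with a row of \<open>G\<close>.\<close>
  have "row H i \<in> building_up_code x (generated_code G)" if "i < 5 + m" for i
  proof (cases "i < 5")
    case True
    then have "vec 5 (\<lambda>j. if i = j then d i else 0) \<in> J_vecs 5"
      using d(1) by (auto simp: J_vecs_def J_iff)
    then show ?thesis
      using zero top[OF True] by (auto simp: building_up_code_def)
  next
    case False
    then have "5 \<le> i"
      by simp
    then obtain k where k: "i = 5 + k"
      by (rule le_Suc_ex[THEN exE])
    then have "k < m"
      using that by simp
    then show ?thesis
      unfolding k building_up_code_def bottom[OF \<open>k < m\<close>]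
      using rowG J_vecs_zero by (intro image_eqI[where x = "(0\<^sub>v 5, row G k)"]) simp_all
  qed
  then have "set (rows H) \<subseteq> building_up_code x (generated_code G)"
    using H by (auto simp: rows_def)
  then show "generated_code H \<subseteq> building_up_code x (generated_code G)"
    using building_up_code_linear[OF x gen(1)] by (intro generated_code_least(3)[OF H])
next
  note gen = generated_code_least[OF H]
  have rowH: "row H i \<in> generated_code H" if "i < 5 + m" for i
    using gen(2) H that by (auto simp: rows_def)
  \<comment> \<open>\<open>E\<close> is the pullback of the code of \<open>H\<close> along
    \<open>c \<mapsto> building_up x 0 c\<close>. Minimality then covers all of
    \<open>generated_code G\<close> without describing its elements as combinations of rows.\<close>
  define E where "E = {c \<in> carrier_vec n. building_up x (0\<^sub>v 5) c \<in> generated_code H}"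
  have "linear_code n E"
    unfolding linear_code_def
  proof (intro conjI ballI allI)
    fix y z assume yz: "y \<in> E" "z \<in> E"
    then have "building_up x (0\<^sub>v 5 + 0\<^sub>v 5) (y + z) =
        building_up x (0\<^sub>v 5) y + building_up x (0\<^sub>v 5) z"
      by (intro building_up_add[OF x]) (auto simp: E_def)
    then show "y + z \<in> E"
      using yz gen(1) by (simp add: E_def linear_code_def)
  next
    fix y r assume y: "y \<in> E"
    then have "building_up x (- 0\<^sub>v 5) (- y) = - building_up x (0\<^sub>v 5) y"
      by (intro building_up_uminus[OF x]) (auto simp: E_def)
    moreover have "- 0\<^sub>v 5 = (0\<^sub>v 5 :: I5 vec)"
      by auto
    ultimately show "- y \<in> E"
      using y gen(1) by (simp add: E_def linear_code_def)
    show "r \<cdot>\<^sub>v y \<in> E"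
      using y gen(1) building_up_smult[OF x J_vecs_zero, of y r, symmetric]
      by (simp add: E_def linear_code_def)
  qed (use gen(1) in \<open>auto simp: E_def linear_code_def building_up_zero[OF x]\<close>)
  moreover have "set (rows G) \<subseteq> E"
  proof -
    have "row G i \<in> E" if "i < m" for i
      using rowH[of "5 + i"] bottom[OF that] G that by (simp add: E_def)
    then show ?thesis
      using G by (auto simp: rows_def)
  qed
  ultimately have E: "generated_code G \<subseteq> E"
    by (rule generated_code_least(3)[OF G])
  have "building_up x v c \<in> generated_code H" if v: "v \<in> J_vecs 5" and "c \<in> generated_code G" for v c
  proof -
    have c: "c \<in> carrier_vec n" "building_up x (0\<^sub>v 5) c \<in> generated_code H"
      using E that(2) by (auto simp: E_def)
    have topH: "building_up x (vec 5 (\<lambda>j. if i = j then d i else 0)) (0\<^sub>v n) \<in> generated_code H"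
      if "i < 5" for i
      using rowH[of i] top[OF that] that by simp
    \<comment> \<open>The pair \<open>(v, c)\<close> is split as \<open>(v, 0) + (0, c)\<close>: the
      top rows account for the first summand, \<open>E\<close> for the second.\<close>
    have "building_up x v (0\<^sub>v n) \<in> generated_code H"
      by (rule building_up_J_vecs_mem[where d = d, OF x gen(1)]) (fact d topH v)+
    moreover have "building_up x v c = building_up x v (0\<^sub>v n) + building_up x (0\<^sub>v 5) c"
      using building_up_add[OF x, of v "0\<^sub>v 5" "0\<^sub>v n" c] J_vecs_carrier[OF v] c by simp
    ultimately show ?thesis
      using c gen(1) by (simp add: linear_code_def)
  qed
  then show "building_up_code x (generated_code G) \<subseteq> generated_code H"
    by (auto simp: building_up_code_def)
qed

section \<open>The displayed generator matrix\<close>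

theorem theorem3p13:
  fixes n m :: nat
    and G\<^sub>0 :: "I5 mat"
    and C\<^sub>0 :: "I5 vec set"
    and x :: "5 vec"
    and \<iota> \<kappa> lam \<mu> \<nu> :: I5
  assumes "G\<^sub>0 \<in> carrier_mat m n"
    and "C\<^sub>0 = generated_code G\<^sub>0"
    and "quasi_self_dual n C\<^sub>0"
    and "x \<in> carrier_vec n"
    and "\<iota> \<in> J" "\<kappa> \<in> J" "lam \<in> J" "\<mu> \<in> J" "\<nu> \<in> J"
    and "\<iota> \<noteq> 0" "\<kappa> \<noteq> 0" "lam \<noteq> 0" "\<mu> \<noteq> 0" "\<nu> \<noteq> 0"
  shows "quasi_self_dual (n + 5)
    (generated_code
      (four_block_mat
        (mat_of_rows_list 5
          [[\<iota>, 0, 0, 0, 0],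
           [0, \<kappa>, 0, 0, 0],
           [0, 0, lam, 0, 0],
           [0, 0, 0, \<mu>, 0],
           [0, 0, 0, 0, \<nu>]])
        (mat_of_rows n
          [ring_times_vec \<iota> x,
           ring_times_vec \<kappa> x,
           ring_times_vec lam x,
           ring_times_vec \<mu> x,
           ring_times_vec \<nu> x])
        (mat m 5 (\<lambda>(i, j). scal 4 (mixed_prod x (row G\<^sub>0 i))))
        G\<^sub>0))"
    (is "quasi_self_dual _ (generated_code (four_block_mat ?A ?B ?C _))")
proof -
  \<comment> \<open>Indexing the five nonzero elements of \<open>J\<close> lets the top rows be
    treated uniformly; \<open>less5\<close> then splits an index into literals so that list lookups
    evaluate.\<close>
  define d where "d i = [\<iota>, \<kappa>, lam, \<mu>, \<nu>] ! i" for i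
  have less5: "i < 5 \<longleftrightarrow> i = 0 \<or> i = 1 \<or> i = 2 \<or> i = 3 \<or> i = 4" for i :: nat
    by auto
  have A: "?A \<in> carrier_mat 5 5"
    by (intro carrier_matI) (simp_all add: mat_of_rows_list_def)
  have B: "?B \<in> carrier_mat 5 n" and C: "?C \<in> carrier_mat m 5"
    by (auto intro!: carrier_matI)
  have H: "four_block_mat ?A ?B ?C G\<^sub>0 \<in> carrier_mat (5 + m) (n + 5)"
    using four_block_carrier_mat[OF A assms(1), of ?B ?C] by (simp add: add.commute)
  have rowA: "row ?A i = vec 5 (\<lambda>j. if i = j then d i else 0)" if "i < 5" for i
  proof (rule eq_vecI)
    fix j assume "j < dim_vec (vec 5 (\<lambda>j. if i = j then d i else 0))"
    then have j: "j < 5" by simp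
    from that j have "row ?A i $ j = [[\<iota>, 0, 0, 0, 0], [0, \<kappa>, 0, 0, 0], [0, 0, lam, 0, 0],
        [0, 0, 0, \<mu>, 0], [0, 0, 0, 0, \<nu>]] ! i ! j"
      by (simp add: mat_of_rows_list_def)
    also have "\<dots> = (if i = j then d i else 0)"
      using that j unfolding less5 by (elim disjE) (simp_all add: d_def)
    finally show "row ?A i $ j = vec 5 (\<lambda>j. if i = j then d i else 0) $ j"
      using j by simp
  qed (simp add: mat_of_rows_list_def)
  have rowB: "row ?B i = ring_times_vec (d i) x" if "i < 5" for i
  proof -
    have "[ring_times_vec \<iota> x, ring_times_vec \<kappa> x, ring_times_vec lam x, ring_times_vec \<mu> x,
        ring_times_vec \<nu> x] ! i = ring_times_vec (d i) x"
      using that unfolding less5 by (elim disjE) (simp_all add: d_def)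
    then show ?thesis
      using that assms(4) by (subst mat_of_rows_row) (auto intro!: carrier_vecI)
  qed
  have top: "row (four_block_mat ?A ?B ?C G\<^sub>0) i =
      building_up x (vec 5 (\<lambda>j. if i = j then d i else 0)) (0\<^sub>v n)" if i: "i < 5" for i
  proof -
    \<comment> \<open>With \<open>c = 0\<close> the left part receives no correction, and the single
      nonzero entry \<open>d i\<close> is the multiplier of \<open>x\<close> on the right.\<close>
    have "(\<Sum>k<5. vec 5 (\<lambda>j. if i = j then d i else 0) $ k) = d i"
      using i by simp
    moreover have "mixed_prod x (0\<^sub>v n) = 0"
      by (simp add: I5_eq_iff)
    ultimately have "building_up x (vec 5 (\<lambda>j. if i = j then d i else 0)) (0\<^sub>v n) =
        vec 5 (\<lambda>j. if i = j then d i else 0) @\<^sub>v ring_times_vec (d i) x"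
      using assms(4) unfolding building_up_def by (intro arg_cong2[where f = append_vec] eq_vecI) (auto simp: I5_eq_iff)
    then show ?thesis
      using row_four_block_mat(1)[OF A B C assms(1) i] rowA[OF i] rowB[OF i] by simp
  qed
  have bottom: "row (four_block_mat ?A ?B ?C G\<^sub>0) (5 + i) = building_up x (0\<^sub>v 5) (row G\<^sub>0 i)"
    if i: "i < m" for i
  proof -
    \<comment> \<open>With \<open>v = 0\<close> the multiplier of \<open>x\<close> is zero, so the
      right part is the unchanged row and the left part is the constant row of
      \<open>?C\<close>.\<close>
    have "building_up x (0\<^sub>v 5) (row G\<^sub>0 i) = row ?C i @\<^sub>v row G\<^sub>0 i"
      using assms(1,4) i unfolding building_up_def
      by (intro arg_cong2[where f = append_vec] eq_vecI) (auto simp: I5_eq_iff)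
    then show ?thesis
      using row_four_block_mat(2)[OF A B C assms(1), of "5 + i"] i by simp
  qed
  have d: "d i \<in> J" "d i \<noteq> 0" if "i < 5" for i
    using that assms(5-14) unfolding less5 by (auto simp: d_def)
  have "generated_code (four_block_mat ?A ?B ?C G\<^sub>0) = building_up_code x C\<^sub>0"
    unfolding assms(2)
    by (rule generated_code_building_up[where d = d, OF assms(1,4)]) (fact d H top bottom)+
  then show ?thesis
    using building_up_code_quasi_self_dual[OF assms(4,3)] by simp
qed

end
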